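(* Let $r\ge1$ and let $a_1,\dots,a_r$ be nonzero complex numbers. For every integer $n\ge0$, \begin{align*} D_{n+1}(x|a_1,\dots,a_r)&=xD_n(x-1|a_1,\dots,a_r)\\ &\quad-\sum_{m=0}^n\left(\sum_{i=m}^n\sum_{l=i}^n\sum_{j=1}^r\frac{1}{i+1}\binom{n}{l}\binom{i+1}{m}S_1(l,i)B_{i+1-m}(-a_j)^{i+1-m}D_{n-l}(a_1,\dots,a_r)\right)(x-1)^m, \end{align*} \begin{align*} \widehat D_{n+1}(x|a_1,\dots,a_r)&=\Big(x+\sum_{j=1}^ra_j\Big)\widehat D_n(x-1|a_1,\dots,a_r)\\ &\quad-\sum_{m=0}^n\left(\sum_{i=m}^n\sum_{l=i}^n\sum_{j=1}^r\frac{1}{i+1}\binom{n}{l}\binom{i+1}{m}S_1(l,i)B_{i+1-m}(-a_j)^{i+1-m}\widehat D_{n-l}(a_1,\dots,a_r)\right)(x-1)^m. \end{align*}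
   Context: For nonzero complex $a_1,\dots,a_r$, the Barnes-type Daehee polynomials of the first and second kind are defined by the formal power series identities $\prod_{j=1}^r\frac{\ln(1+t)}{(1+t)^{a_j}-1}(1+t)^x=\sum_{n\ge0}D_n(x|a_1,\dots,a_r)\frac{t^n}{n!}$ and $\prod_{j=1}^r\frac{(1+t)^{a_j}\ln(1+t)}{(1+t)^{a_j}-1}(1+t)^x=\sum_{n\ge0}\widehat D_n(x|a_1,\dots,a_r)\frac{t^n}{n!}$; the numbers are $D_n(a_1,\dots,a_r)=D_n(0|a_1,\dots,a_r)$ and $\widehat D_n(a_1,\dots,a_r)=\widehat D_n(0|a_1,\dots,a_r)$. $S_1(n,m)$ are the signed Stirling numbers of the first kind: $x(x-1)\cdots(x-n+1)=\sum_{m=0}^nS_1(n,m)x^m$. $B_n$ is the $n$th ordinary Bernoulli number, $\frac{t}{e^t-1}=\sum_{n\ge0}B_n\frac{t^n}{n!}$. *)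

theory Defs
  imports "HOL-Computational_Algebra.Computational_Algebra"
begin

text \<open>
  All generating functions are formal power series in \<open>t\<close> over the complex numbers:
  \<^term>\<open>fps_ln 1\<close> is \<open>ln (1 + t)\<close> and \<^term>\<open>fps_binomial c\<close> is \<open>(1 + t)\<^sup>c\<close>.
  The quotients below are genuine, although the denominators have constant term 0:
  division of formal power series over a field cancels common powers of \<open>t\<close>, and
  \<open>(1 + t)\<^sup>c - 1\<close> has order exactly 1 for \<open>c \<noteq> 0\<close>, as have \<open>ln (1 + t)\<close> and \<open>e\<^sup>t - 1\<close>.

  The parameters \<open>a\<^sub>1, \<dots>, a\<^sub>r\<close> are the values \<open>a 1, \<dots>, a r\<close> of a function
  \<open>a\<close>; its other values are not used. The polynomials are rendered by the
  functions of a complex argument \<open>x\<close> that they induce.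
\<close>

definition daehee_poly :: "nat \<Rightarrow> (nat \<Rightarrow> complex) \<Rightarrow> nat \<Rightarrow> complex \<Rightarrow> complex" where
  "daehee_poly r a n x =
     fact n * fps_nth ((\<Prod>j=1..r. fps_ln 1 / (fps_binomial (a j) - 1)) * fps_binomial x) n"

definition daehee_poly2 :: "nat \<Rightarrow> (nat \<Rightarrow> complex) \<Rightarrow> nat \<Rightarrow> complex \<Rightarrow> complex" where
  "daehee_poly2 r a n x =
     fact n * fps_nth ((\<Prod>j=1..r. (fps_binomial (a j) * fps_ln 1) / (fps_binomial (a j) - 1))
                        * fps_binomial x) n"

definition daehee_num :: "nat \<Rightarrow> (nat \<Rightarrow> complex) \<Rightarrow> nat \<Rightarrow> complex" where
  "daehee_num r a n = daehee_poly r a n 0"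

definition daehee_num2 :: "nat \<Rightarrow> (nat \<Rightarrow> complex) \<Rightarrow> nat \<Rightarrow> complex" where
  "daehee_num2 r a n = daehee_poly2 r a n 0"

text \<open>Signed Stirling numbers of the first kind (the constant \<open>stirling\<close> of
  \<open>HOL-Combinatorics\<close> is the unsigned version).\<close>

definition stirling1 :: "nat \<Rightarrow> nat \<Rightarrow> int" where
  "stirling1 n m = coeff (\<Prod>k<n. [:- int k, 1:]) m"

definition bernoulli_num :: "nat \<Rightarrow> complex" where
  "bernoulli_num n = fact n * fps_nth (fps_X / (fps_exp 1 - 1)) n"

end

theory Submission
  imports Defs
begin

text \<open>
  If a power series \<open>Q\<close> satisfies \<open>(1 + t) Q' = Q (s - \<Sum>\<^sub>j K\<^sub>j(ln (1 + t)))\<close>, then the derivative of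
  \<open>Q (1 + t)\<^sup>x\<close> is \<open>(1 + t)\<^sup>x\<^sup>-\<^sup>1 Q (x + s - \<Sum>\<^sub>j K\<^sub>j(ln (1 + t)))\<close>, and the recurrence follows on comparing
  coefficients, since \<open>(1 + t)\<^sup>x\<^sup>-\<^sup>1 = exp ((x - 1) ln (1 + t))\<close> and the powers of \<open>ln (1 + t)\<close> generate
  the Stirling numbers of the first kind. Both Daehee products are of this kind with
  \<open>K\<^sub>j(u) = (\<beta>(-a\<^sub>j u) - 1) / u\<close>, where \<open>\<beta>(u) = u / (e\<^sup>u - 1)\<close>, because the logarithmic derivative of
  \<open>ln (1 + t) / ((1 + t)\<^sup>a - 1)\<close> is \<open>(1 - \<beta>(-a u)) / ((1 + t) u)\<close> at \<open>u = ln (1 + t)\<close>. The second kind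
  carries the additional factor \<open>(1 + t)\<^bsup>\<Sum>a\<^sub>j\<^esup>\<close>, which contributes \<open>s = \<Sum>a\<^sub>j\<close>.
\<close>

abbreviation Ln1 :: "complex fps" where "Ln1 \<equiv> fps_ln 1"

text \<open>Writing 1/(1 + t) as \<open>fps_binomial (- 1)\<close> keeps the derivative rules free
  of division, so later steps are plain ring computations.\<close>

lemma fps_deriv_binomial:
  "fps_deriv (fps_binomial c) = fps_const c * fps_binomial c * fps_binomial (- 1)"
  by (simp add: fps_binomial_deriv fps_binomial_minus_one fps_divide_unit)

lemma fps_deriv_Ln1: "fps_deriv Ln1 = fps_binomial (- 1)"
  by (simp add: fps_ln_deriv fps_binomial_minus_one)

text \<open>Both sides solve (1 + t) y' = c y, whose solution is fixed by its constant term, here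
  1.\<close>

lemma fps_exp_compose_Ln1: "fps_exp c oo Ln1 = fps_binomial c"
proof -
  have "fps_deriv (fps_exp c oo Ln1) = fps_const c * (fps_exp c oo Ln1) / (1 + fps_X)"
    by (simp add: fps_compose_deriv fps_deriv_Ln1 fps_binomial_minus_one fps_divide_unit
        fps_compose_mult_distrib mult.assoc)
  then show ?thesis
    using fps_binomial_ODE_unique'[of "fps_exp c oo Ln1" c] by simp
qed

lemma of_int_stirling1:
  "of_int (stirling1 n i) = coeff (\<Prod>k<n. [:- of_nat k, 1 :: complex:]) i"
proof -
  have "coeff (\<Prod>k<n. [:- of_nat k, 1 :: complex:]) i
      = of_int (coeff (\<Prod>k<n. [:- int k, 1:]) i)"
    by (induction n arbitrary: i)
      (simp_all add: mult_pCons_right coeff_pCons coeff_1 split: nat.split)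
  then show ?thesis
    by (simp add: stirling1_def)
qed

text \<open>The coefficient of t^l in exp (z ln (1 + t)) = (1 + t)^z is a polynomial in z in two
  ways: \<open>p\<close> from the exponential series, \<open>q\<close> from the falling factorial.
  They agree at every complex z, hence coefficientwise.\<close>

lemma Ln1_power_nth: "fps_nth (Ln1 ^ i) l = fact i * of_int (stirling1 l i) / fact l"
proof (cases "i \<le> l")
  case True
  define p where "p = (\<Sum>k\<le>l. monom (fps_nth (Ln1 ^ k) l / fact k) k)"
  define q where "q = smult (1 / fact l) (\<Prod>k<l. [:- of_nat k, 1 :: complex:])"
  have "poly p z = poly q z" for z
  proof -
    have "poly p z = (\<Sum>k\<le>l. (z ^ k / fact k) * fps_nth (Ln1 ^ k) l)"
      by (simp add: p_def poly_sum poly_monom mult_ac)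
    also have "\<dots> = fps_nth (fps_exp z oo Ln1) l"
      by (simp add: fps_compose_nth atLeast0AtMost)
    also have "\<dots> = z gchoose l"
      by (simp add: fps_exp_compose_Ln1)
    also have "\<dots> = poly q z"
      by (simp add: q_def poly_prod gbinomial_prod_rev atLeast0LessThan)
    finally show ?thesis .
  qed
  then have "coeff p i = coeff q i"
    by (metis poly_eq_poly_eq_iff ext)
  moreover have "coeff p i = fps_nth (Ln1 ^ i) l / fact i"
    using True by (simp add: p_def coeff_sum coeff_monom)
  ultimately show ?thesis
    by (simp add: q_def of_int_stirling1 field_simps)
next
  case False
  \<comment> \<open>For i > l both sides vanish: the falling factorial has degree at most l, and ln
    (1 + t)^i has order at least i.\<close>
  have "degree (\<Prod>k<l. [:- of_nat k, 1 :: complex:]) \<le> l"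
    by (rule order_trans[OF degree_prod_sum_le]) auto
  then have "of_int (stirling1 l i) = (0 :: complex)"
    using False by (simp only: of_int_stirling1 coeff_eq_0)
  moreover have "fps_nth (Ln1 ^ i) l = 0"
    using False by (intro fps_pow_nth_below_subdegree startsby_zero_power_prefix[rule_format]) auto
  ultimately show ?thesis by simp
qed

text \<open>This is (\<beta>(c u) - 1) / u; the index shift performs the division by u once the
  constant term 1 is removed.\<close>

definition bern_kernel :: "complex \<Rightarrow> complex fps" where
  "bern_kernel c = Abs_fps (\<lambda>i. bernoulli_num (i + 1) * c ^ (i + 1) / fact (i + 1))"

lemma bernoulli_fps_mult:
  fixes F :: "complex fps"
  defines "F \<equiv> fps_X / (fps_exp 1 - 1)"
  shows "F * (fps_exp 1 - 1) = fps_X" and "fps_nth F 0 = 1"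
proof -
  have nz: "fps_exp 1 - 1 \<noteq> (0 :: complex fps)"
    by (auto simp: fps_eq_iff intro!: exI[of _ 1])
  have "subdegree (fps_exp 1 - 1 :: complex fps) = 1"
    by (rule subdegreeI) auto
  then have "(fps_exp 1 - 1 :: complex fps) dvd fps_X"
    using nz by (simp add: fps_dvd_iff)
  then show *: "F * (fps_exp 1 - 1) = fps_X"
    by (simp add: F_def)
  have "fps_nth (F * (fps_exp 1 - 1)) 1 = 1"
    by (simp add: *)
  then show "fps_nth F 0 = 1"
    by (simp add: fps_mult_nth)
qed

text \<open>Substituting c u into \<beta>(u) (e^u - 1) = u and subtracting e^(c u) - 1 gives a
  quotient-free form of the kernel.\<close>

lemma X_mult_bern_kernel:
  "fps_X * bern_kernel c * (fps_exp c - 1) = fps_const c * fps_X - (fps_exp c - 1)"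
proof -
  define F :: "complex fps" where "F = fps_X / (fps_exp 1 - 1)"
  define G where "G = F oo (fps_const c * fps_X)"
  have "fps_X * bern_kernel c = G - 1"
  proof (rule fps_ext)
    fix i show "fps_nth (fps_X * bern_kernel c) i = fps_nth (G - 1) i"
      using bernoulli_fps_mult(2)
      by (cases i) (simp_all add: G_def bern_kernel_def bernoulli_num_def F_def
          del: of_nat_Suc)
  qed
  moreover have "G * (fps_exp c - 1) = fps_const c * fps_X"
  proof -
    have "(F * (fps_exp 1 - 1)) oo (fps_const c * fps_X) = fps_const c * fps_X"
      unfolding F_def bernoulli_fps_mult(1) by simp
    then show ?thesis
      by (simp add: fps_compose_mult_distrib fps_compose_sub_distrib G_def)
  qed
  ultimately show ?thesis
    by (simp add: left_diff_distrib)
qed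

lemma Ln1_nonzero: "Ln1 \<noteq> 0"
  by (auto simp: fps_eq_iff fps_ln_nth intro!: exI[of _ 1])

lemma daehee_factor:
  fixes c :: complex
  assumes "c \<noteq> 0"
  defines "f \<equiv> Ln1 / (fps_binomial c - 1)"
  shows "f * (fps_binomial c - 1) = Ln1"
    and "(fps_binomial c * Ln1) / (fps_binomial c - 1) = fps_binomial c * f"
    and "fps_deriv f = - fps_binomial (- 1) * f * (bern_kernel (- c) oo Ln1)"
proof -
  let ?b = "fps_binomial c" and ?d = "fps_binomial (- 1) :: complex fps"
  let ?K = "bern_kernel (- c) oo Ln1"
  have nth1: "fps_nth (?b - 1) 1 = c" by simp
  then have nz: "?b - 1 \<noteq> 0" using assms by (metis fps_zero_nth)
  have "subdegree (?b - 1) = 1"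
    by (rule subdegreeI) (use assms in auto)
  moreover have "subdegree Ln1 = 1"
    by (rule subdegreeI) (auto simp: fps_ln_nth)
  ultimately have dvd: "(?b - 1) dvd Ln1"
    using nz Ln1_nonzero by (simp add: fps_dvd_iff)
  then show eq: "f * (?b - 1) = Ln1"
    by (simp add: f_def)
  show "(?b * Ln1) / (?b - 1) = ?b * f"
    using dvd by (simp add: f_def div_mult_swap)
  have deriv: "fps_deriv f * (?b - 1) + f * (fps_const c * ?b * ?d) = ?d"
    using arg_cong[OF eq, of fps_deriv]
    by (simp add: fps_deriv_binomial fps_deriv_Ln1 algebra_simps)
  have inv: "?b * fps_binomial (- c) = 1"
    by (simp flip: fps_binomial_add_mult)
  have "Ln1 * ?K * (fps_binomial (- c) - 1) = - fps_const c * Ln1 - (fps_binomial (- c) - 1)"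
    using arg_cong[OF X_mult_bern_kernel[of "- c"], of "\<lambda>h. h oo Ln1"]
    by (simp add: fps_compose_mult_distrib fps_compose_sub_distrib fps_exp_compose_Ln1
        fps_compose_uminus flip: fps_const_neg)
  \<comment> \<open>Multiplication by -(1 + t)^c turns (1 + t)^(-c) - 1 into (1 + t)^c - 1, the
    denominator of \<open>f\<close>.\<close>
  then have K: "Ln1 * ?K * (?b - 1) = fps_const c * ?b * Ln1 - (?b - 1)"
    using inv by algebra
  \<comment> \<open>Neither (1 + t)^c - 1 nor ln (1 + t) is a unit, but both are nonzero, so they
    can be cancelled in the integral domain of power series.\<close>
  have "(fps_deriv f + ?d * f * ?K) * ((?b - 1) * Ln1) = 0"
  proof -
    have "(fps_deriv f + ?d * f * ?K) * ((?b - 1) * Ln1)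
        = (fps_deriv f * (?b - 1)) * Ln1 + ?d * f * (Ln1 * ?K * (?b - 1))"
      by (simp add: algebra_simps)
    also have "fps_deriv f * (?b - 1) = ?d - f * (fps_const c * ?b * ?d)"
      using deriv by (simp add: eq_diff_eq)
    also have "(?d - f * (fps_const c * ?b * ?d)) * Ln1 + ?d * f * (Ln1 * ?K * (?b - 1))
        = ?d * (Ln1 - f * (?b - 1))"
      unfolding K by (simp add: algebra_simps)
    finally show ?thesis
      by (simp add: eq)
  qed
  then show "fps_deriv f = - ?d * f * ?K"
    using nz Ln1_nonzero by (simp add: eq_neg_iff_add_eq_0)
qed

lemma fps_deriv_prod_logderiv:
  fixes f g :: "'b \<Rightarrow> 'a :: comm_ring_1 fps"
  assumes "finite J" and "\<And>j. j \<in> J \<Longrightarrow> fps_deriv (f j) = h * f j * g j"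
  shows "fps_deriv (prod f J) = h * prod f J * sum g J"
  using assms by (induction J rule: finite_induct) (simp_all add: algebra_simps)

lemma sum_swap_triple:
  fixes F :: "nat \<Rightarrow> nat \<Rightarrow> nat \<Rightarrow> 'a :: comm_monoid_add"
  shows "(\<Sum>l=0..n. \<Sum>i=0..l. \<Sum>m=0..i. F m i l) = (\<Sum>m=0..n. \<Sum>i=m..n. \<Sum>l=i..n. F m i l)"
proof -
  have swap: "(\<Sum>i=0..n. \<Sum>j=0..i. G i j) = (\<Sum>j=0..n. \<Sum>i=j..n. G i j)"
    for G :: "nat \<Rightarrow> nat \<Rightarrow> 'a"
    by (induction n) (simp_all add: sum.distrib)
  have "(\<Sum>l=0..n. \<Sum>i=0..l. \<Sum>m=0..i. F m i l) = (\<Sum>i=0..n. \<Sum>l=i..n. \<Sum>m=0..i. F m i l)"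
    by (rule swap)
  also have "\<dots> = (\<Sum>i=0..n. \<Sum>m=0..i. \<Sum>l=i..n. F m i l)"
    by (intro sum.cong refl sum.swap)
  also have "\<dots> = (\<Sum>m=0..n. \<Sum>i=m..n. \<Sum>l=i..n. F m i l)"
    by (rule swap)
  finally show ?thesis .
qed

lemma compose_Ln1_nth:
  "fact l * fps_nth (g oo Ln1) l = (\<Sum>i=0..l. fact i * of_int (stirling1 l i) * fps_nth g i)"
  by (simp add: fps_compose_nth Ln1_power_nth sum_distrib_left mult_ac)

text \<open>The Cauchy product yields i! / (m! (i + 1 - m)!), which is binomial (i + 1, m) divided
  by i + 1.\<close>

lemma exp_mult_bern_kernel_nth:
  "fact i * fps_nth (fps_exp y * bern_kernel c) i =
     (\<Sum>m=0..i. 1 / of_nat (i + 1) * of_nat ((i + 1) choose m) * bernoulli_num (i + 1 - m)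
        * c ^ (i + 1 - m) * y ^ m)"
  unfolding fps_mult_nth sum_distrib_left
proof (rule sum.cong[OF refl])
  fix m assume "m \<in> {0..i}"
  then have m: "m \<le> i" by simp
  have "of_nat ((i + 1) choose m) = (fact (i + 1) / (fact m * fact (i + 1 - m)) :: complex)"
    using m by (intro binomial_fact) simp
  then show "fact i * (fps_nth (fps_exp y) m * fps_nth (bern_kernel c) (i - m)) =
      1 / of_nat (i + 1) * of_nat ((i + 1) choose m) * bernoulli_num (i + 1 - m)
        * c ^ (i + 1 - m) * y ^ m"
    using m by (simp add: bern_kernel_def Suc_diff_le field_simps del: of_nat_Suc)
qed

lemma daehee_recurrence:
  fixes Q :: "complex fps" and s :: complex and a :: "nat \<Rightarrow> complex"
  defines "d \<equiv> \<lambda>n x. fact n * fps_nth (Q * fps_binomial x) n"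
  assumes deriv: "fps_deriv Q =
    fps_binomial (- 1) * Q * (fps_const s - (\<Sum>j\<in>J. bern_kernel (- a j) oo Ln1))"
  shows "d (n + 1) x = (x + s) * d n (x - 1)
           - (\<Sum>m=0..n. (\<Sum>i=m..n. \<Sum>l=i..n. \<Sum>j\<in>J.
                1 / of_nat (i + 1) * of_nat (n choose l) * of_nat ((i + 1) choose m)
                * of_int (stirling1 l i) * bernoulli_num (i + 1 - m)
                * (- a j) ^ (i + 1 - m) * d (n - l) 0) * (x - 1) ^ m)"
proof -
  define K where "K j = bern_kernel (- a j)" for j
  \<comment> \<open>Absorbing (1 + t)^(x - 1) into a series in u = ln (1 + t) produces the powers of
    x - 1 and leaves \<open>Q\<close> alone as the other factor, whose coefficients give the values
    \<open>d (n - l) 0\<close>.\<close>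
  define T where "T = (\<Sum>j\<in>J. fps_exp (x - 1) * K j)"
  have b: "fps_binomial (x - 1) = fps_binomial x * fps_binomial (- 1)"
    by (simp flip: fps_binomial_add_mult)
  have T: "T oo Ln1 = fps_binomial (x - 1) * (\<Sum>j\<in>J. K j oo Ln1)"
    by (simp add: T_def fps_compose_sum_distrib fps_compose_mult_distrib fps_exp_compose_Ln1
        sum_distrib_left)
  have Q': "fps_deriv (Q * fps_binomial x)
      = fps_const (x + s) * (Q * fps_binomial (x - 1)) - (T oo Ln1) * Q"
    unfolding fps_deriv_mult deriv fps_deriv_binomial T b K_def fps_const_add[symmetric]
    by (simp add: algebra_simps del: fps_const_add)
  have "d (n + 1) x = fact n * fps_nth (fps_deriv (Q * fps_binomial x)) n"
    by (simp add: d_def mult_ac del: fps_deriv_mult)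
  then have "d (n + 1) x = (x + s) * d n (x - 1) - fact n * fps_nth ((T oo Ln1) * Q) n"
    unfolding Q' by (simp add: d_def right_diff_distrib mult.left_commute[of "x + s"])
  also have "fact n * fps_nth ((T oo Ln1) * Q) n
      = (\<Sum>l=0..n. of_nat (n choose l) * d (n - l) 0 * (fact l * fps_nth (T oo Ln1) l))"
    unfolding fps_mult_nth[of "T oo Ln1"] sum_distrib_left
    by (intro sum.cong refl) (simp add: d_def binomial_fact)
  also have "\<dots> = (\<Sum>l=0..n. \<Sum>i=0..l. \<Sum>m=0..i. \<Sum>j\<in>J.
        1 / of_nat (i + 1) * of_nat (n choose l) * of_nat ((i + 1) choose m)
        * of_int (stirling1 l i) * bernoulli_num (i + 1 - m)
        * (- a j) ^ (i + 1 - m) * d (n - l) 0 * (x - 1) ^ m)"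
  proof (intro sum.cong refl)
    fix l
    let ?c = "of_nat (n choose l) * d (n - l) 0"
    have "?c * (fact l * fps_nth (T oo Ln1) l)
        = (\<Sum>i=0..l. ?c * of_int (stirling1 l i)
            * (\<Sum>j\<in>J. fact i * fps_nth (fps_exp (x - 1) * K j) i))"
      unfolding compose_Ln1_nth T_def
      by (simp add: fps_sum_nth sum_distrib_left mult_ac)
    also have "\<dots> = (\<Sum>i=0..l. \<Sum>m=0..i. \<Sum>j\<in>J. ?c * of_int (stirling1 l i)
        * (1 / of_nat (i + 1) * of_nat ((i + 1) choose m) * bernoulli_num (i + 1 - m)
            * (- a j) ^ (i + 1 - m) * (x - 1) ^ m))"
      unfolding K_def exp_mult_bern_kernel_nth sum_distrib_left
      by (intro sum.cong refl sum.swap)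
    finally show "?c * (fact l * fps_nth (T oo Ln1) l) = (\<Sum>i=0..l. \<Sum>m=0..i. \<Sum>j\<in>J.
        1 / of_nat (i + 1) * of_nat (n choose l) * of_nat ((i + 1) choose m)
        * of_int (stirling1 l i) * bernoulli_num (i + 1 - m)
        * (- a j) ^ (i + 1 - m) * d (n - l) 0 * (x - 1) ^ m)"
      by (simp only: mult_ac)
  qed
  finally show ?thesis
    by (simp only: sum_swap_triple sum_distrib_right)
qed

lemma fps_binomial_sum:
  "finite J \<Longrightarrow> fps_binomial (\<Sum>j\<in>J. a j) = (\<Prod>j\<in>J. fps_binomial (a j :: complex))"
  by (induction J rule: finite_induct) (simp_all add: fps_binomial_add_mult)

theorem theorem4:
  fixes r :: nat and a :: "nat \<Rightarrow> complex" and n :: nat and x :: complex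
  assumes "r \<ge> 1"
    and "\<And>j. j \<in> {1..r} \<Longrightarrow> a j \<noteq> 0"
  shows "daehee_poly r a (n + 1) x =
           x * daehee_poly r a n (x - 1)
           - (\<Sum>m=0..n. (\<Sum>i=m..n. \<Sum>l=i..n. \<Sum>j=1..r.
                1 / of_nat (i + 1) * of_nat (n choose l) * of_nat ((i + 1) choose m)
                * of_int (stirling1 l i) * bernoulli_num (i + 1 - m)
                * (- a j) ^ (i + 1 - m) * daehee_num r a (n - l)) * (x - 1) ^ m)
         \<and>
         daehee_poly2 r a (n + 1) x =
           (x + (\<Sum>j=1..r. a j)) * daehee_poly2 r a n (x - 1)
           - (\<Sum>m=0..n. (\<Sum>i=m..n. \<Sum>l=i..n. \<Sum>j=1..r.
                1 / of_nat (i + 1) * of_nat (n choose l) * of_nat ((i + 1) choose m)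
                * of_int (stirling1 l i) * bernoulli_num (i + 1 - m)
                * (- a j) ^ (i + 1 - m) * daehee_num2 r a (n - l)) * (x - 1) ^ m)"
proof (intro conjI)
  define P where "P = (\<Prod>j=1..r. Ln1 / (fps_binomial (a j) - 1))"
  define s where "s = (\<Sum>j=1..r. a j)"
  define KS where "KS = (\<Sum>j=1..r. bern_kernel (- a j) oo Ln1)"
  \<comment> \<open>The term \<open>fps_const 0\<close> casts the first kind as the case s = 0 of
    the common recurrence.\<close>
  have deriv: "fps_deriv P = fps_binomial (- 1) * P * (fps_const 0 - KS)"
    using fps_deriv_prod_logderiv[of "{1..r}" "\<lambda>j. Ln1 / (fps_binomial (a j) - 1)"
        "- fps_binomial (- 1)" "\<lambda>j. bern_kernel (- a j) oo Ln1"] daehee_factor(3) assms(2)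
    by (simp add: P_def KS_def)
  have d1: "daehee_poly r a n x = fact n * fps_nth (P * fps_binomial x) n" for n x
    by (simp add: daehee_poly_def P_def)
  show "daehee_poly r a (n + 1) x =
           x * daehee_poly r a n (x - 1)
           - (\<Sum>m=0..n. (\<Sum>i=m..n. \<Sum>l=i..n. \<Sum>j=1..r.
                1 / of_nat (i + 1) * of_nat (n choose l) * of_nat ((i + 1) choose m)
                * of_int (stirling1 l i) * bernoulli_num (i + 1 - m)
                * (- a j) ^ (i + 1 - m) * daehee_num r a (n - l)) * (x - 1) ^ m)"
    using daehee_recurrence[OF deriv[unfolded KS_def], of n x]
    by (simp only: daehee_num_def d1 add_0_right)
  have deriv2: "fps_deriv (P * fps_binomial s)
      = fps_binomial (- 1) * (P * fps_binomial s) * (fps_const s - KS)"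
    by (simp add: deriv fps_deriv_binomial algebra_simps)
  \<comment> \<open>Pulling each (1 + t)^(a j) out of its quotient shows the second-kind product to
    be \<open>P * fps_binomial s\<close>.\<close>
  have "(\<Prod>j=1..r. (fps_binomial (a j) * Ln1) / (fps_binomial (a j) - 1))
      = (\<Prod>j=1..r. fps_binomial (a j) * (Ln1 / (fps_binomial (a j) - 1)))"
    by (intro prod.cong refl daehee_factor(2) assms(2))
  then have d2: "daehee_poly2 r a n x = fact n * fps_nth (P * fps_binomial s * fps_binomial x) n"
    for n x
    by (simp add: daehee_poly2_def P_def s_def fps_binomial_sum prod.distrib mult_ac)
  show "daehee_poly2 r a (n + 1) x =
           (x + (\<Sum>j=1..r. a j)) * daehee_poly2 r a n (x - 1)
           - (\<Sum>m=0..n. (\<Sum>i=m..n. \<Sum>l=i..n. \<Sum>j=1..r.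
                1 / of_nat (i + 1) * of_nat (n choose l) * of_nat ((i + 1) choose m)
                * of_int (stirling1 l i) * bernoulli_num (i + 1 - m)
                * (- a j) ^ (i + 1 - m) * daehee_num2 r a (n - l)) * (x - 1) ^ m)"
    using daehee_recurrence[OF deriv2[unfolded KS_def], of n x]
    by (simp only: daehee_num2_def d2 flip: s_def)
qed

end
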